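(* Every bi-infinite binary word avoiding the formula $AA.ABAB.BB$ and the factor $\texttt{11}$ has the same set of finite factors as the period-doubling word ${\bf pd}$.
   Context: The period-doubling word ${\bf pd}$ is the fixed point starting with $\texttt{0}$ of the morphism $\texttt{0}\mapsto\texttt{01}$, $\texttt{1}\mapsto\texttt{00}$. A word $w$ contains an occurrence of the formula $AA.ABAB.BB$ if there is a non-erasing morphism $h$ from $\{A,B\}^*$ to binary words such that each of $h(AA)$, $h(ABAB)$ and $h(BB)$ is a factor of $w$ (not necessarily at related positions); $w$ avoids the formula if no such $h$ exists. *)

theory Defs
  imports "HOL-Library.Stream"
begin

datatype letter = Zero | One

datatype pvar = VA | VB

text \<open>A morphism of free monoids is given by the images of the letters.\<close>

definition morph :: "('a \<Rightarrow> 'b list) \<Rightarrow> 'a list \<Rightarrow> 'b list" where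
  "morph h w = concat (map h w)"

definition nonerasing :: "('a \<Rightarrow> 'b list) \<Rightarrow> bool" where
  "nonerasing h \<longleftrightarrow> (\<forall>a. h a \<noteq> [])"

definition stream_factors :: "'a stream \<Rightarrow> 'a list set" where
  "stream_factors x = {w. \<exists>p s. x = p @- w @- s}"

text \<open>For \<open>j < i\<close> the interval \<open>[i..j]\<close> is empty, so the empty word is a factor.\<close>

definition biinf_factors :: "(int \<Rightarrow> 'a) \<Rightarrow> 'a list set" where
  "biinf_factors x = {map x [i..j] | i j. True}"

text \<open>A formula is the list of its fragments; occurrence in a word depends only on the
  set of factors of that word.\<close>

definition contains_formula :: "'b list set \<Rightarrow> 'a list list \<Rightarrow> bool" where
  "contains_formula L \<phi> \<longleftrightarrow> (\<exists>h. nonerasing h \<and> (\<forall>u\<in>set \<phi>. morph h u \<in> L))"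

definition AA_ABAB_BB :: "pvar list list" where
  "AA_ABAB_BB = [[VA, VA], [VA, VB, VA, VB], [VB, VB]]"

fun pd_morph :: "letter \<Rightarrow> letter list" where
  "pd_morph Zero = [Zero, One]"
| "pd_morph One = [Zero, Zero]"

text \<open>For a non-erasing morphism \<open>h\<close>, the image of an infinite word \<open>x\<close> is \<open>flat (smap h x)\<close>.\<close>

definition pd :: "letter stream" where
  "pd = (THE x. shd x = Zero \<and> flat (smap pd_morph x) = x)"

lemma pd_morph_image_snth:
  "flat (smap pd_morph x) !! (2 * n) = Zero"
  "flat (smap pd_morph x) !! Suc (2 * n) = (if x !! n = Zero then One else Zero)"
proof (induction n arbitrary: x)
  case 0
  { case 1 show ?case by (cases x; cases "shd x") simp_all }
  { case 2 show ?case by (cases x; cases "shd x") simp_all }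
next
  case (Suc n)
  have *: "flat (smap pd_morph x) !! Suc (Suc k) = flat (smap pd_morph (stl x)) !! k" for k and x :: "letter stream"
    by (cases x; cases "shd x") simp_all
  { case 1 show ?case using Suc(1)[of "stl x"] *[of x "2 * n"] by (simp del: snth.simps) }
  { case 2 show ?case using Suc(2)[of "stl x"] *[of x "Suc (2 * n)"]
      by (simp del: snth.simps add: snth.simps(2)[of x n]) }
qed

function pd_letter :: "nat \<Rightarrow> letter" where
  "pd_letter n = (if even n then Zero else if pd_letter (n div 2) = Zero then One else Zero)"
  by pat_completeness auto
termination
  by (relation "measure id") (auto elim: oddE)

declare pd_letter.simps [simp del]

lemma pd_fixed_point_iff:
  "shd x = Zero \<and> flat (smap pd_morph x) = x \<longleftrightarrow> x = smap pd_letter (fromN 0)"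
proof
  assume fix_x: "shd x = Zero \<and> flat (smap pd_morph x) = x"
  have "x !! n = pd_letter n" for n
  proof (induction n rule: less_induct)
    case (less n)
    show ?case
    proof (cases "even n")
      case True
      then obtain m where "n = 2 * m" by blast
      then show ?thesis
        using pd_morph_image_snth(1)[of x m] fix_x by (simp add: pd_letter.simps)
    next
      case False
      then obtain m where m: "n = Suc (2 * m)" by (auto elim: oddE)
      then show ?thesis
        using pd_morph_image_snth(2)[of x m] fix_x less[of m] pd_letter.simps[of n] by simp
    qed
  qed
  then show "x = smap pd_letter (fromN 0)"
    by (intro sym[of _ x]) (simp add: smap_alt)
next
  assume x: "x = smap pd_letter (fromN 0)"
  have "flat (smap pd_morph x) !! n = x !! n" for n
  proof (cases "even n")
    case True
    then obtain m where "n = 2 * m" by blast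
    then show ?thesis
      using pd_morph_image_snth(1)[of x m] x by (simp add: pd_letter.simps)
  next
    case False
    then obtain m where m: "n = Suc (2 * m)" by (auto elim: oddE)
    then show ?thesis
      using pd_morph_image_snth(2)[of x m] x pd_letter.simps[of n] by simp
  qed
  then have "smap id (flat (smap pd_morph x)) = x"
    by (simp only: smap_alt id_apply) simp
  then show "shd x = Zero \<and> flat (smap pd_morph x) = x"
    using x by (simp add: stream.map_id0 pd_letter.simps)
qed

lemma pd_ex1: "\<exists>!x. shd x = Zero \<and> flat (smap pd_morph x) = x"
  unfolding pd_fixed_point_iff by blast

lemma pd_fixed_point: "shd pd = Zero" "flat (smap pd_morph pd) = pd"
  using theI'[OF pd_ex1] unfolding pd_def by blast+

end

theory Submission
  imports Defs
begin

text \<open>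
  Write \<open>\<phi>\<close> for the period-doubling morphism. An occurrence of \<open>1001\<close> in \<open>w\<close> would force a fourth
  power of \<open>100\<close> to its right, which is an occurrence of the formula with \<open>A = B = 100\<close>. As \<open>11\<close>
  and \<open>0000\<close> do not occur either, consecutive ones have even distance, so \<open>w\<close> is a shift of
  \<open>\<phi>(w')\<close>. Here \<open>w'\<close> avoids the formula because \<open>\<phi>\<close> maps occurrences to occurrences, and it avoids
  \<open>11\<close> because \<open>\<phi>(11) = 0000\<close>. Since both \<open>w\<close> and \<open>pd\<close> can be desubstituted in this way, their
  factors of length \<open>n \<ge> 3\<close> are compared by induction through shorter factors of their preimages;
  in length at most 2 both words contain everything but \<open>11\<close>.
\<close>

section \<open>Occurrences and factors\<close>

text \<open>Words are functions on an index semiring so that \<open>int\<close> (bi-infinite words) and \<open>nat\<close>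
  (one-sided words) are treated at once.\<close>

definition occurs_at :: "('i::comm_semiring_1 \<Rightarrow> 'a) \<Rightarrow> 'i \<Rightarrow> 'a list \<Rightarrow> bool" where
  "occurs_at x i u \<longleftrightarrow> (\<forall>k<length u. x (i + of_nat k) = u ! k)"

definition factors :: "('i::comm_semiring_1 \<Rightarrow> 'a) \<Rightarrow> 'a list set" where
  "factors x = {u. \<exists>i. occurs_at x i u}"

lemma occurs_at_Nil [simp]: "occurs_at x i []"
  by (simp add: occurs_at_def)

lemma occurs_at_Cons [simp]: "occurs_at x i (a # u) \<longleftrightarrow> x i = a \<and> occurs_at x (i + 1) u"
  unfolding occurs_at_def by (auto simp: less_Suc_eq_0_disj add_ac)

lemma factorsI: "occurs_at x i u \<Longrightarrow> u \<in> factors x"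
  unfolding factors_def by blast

lemma biinf_factors_eq_factors: "biinf_factors x = factors x"
proof (intro set_eqI iffI)
  fix u assume "u \<in> biinf_factors x"
  then obtain i j where u: "u = map x [i..j]"
    unfolding biinf_factors_def by blast
  then have "occurs_at x i u"
    by (simp add: occurs_at_def)
  then show "u \<in> factors x" by (rule factorsI)
next
  fix u assume "u \<in> factors x"
  then obtain i where "occurs_at x i u" unfolding factors_def by blast
  then have "u = map x [i..i + int (length u) - 1]"
    by (intro nth_equalityI) (auto simp: occurs_at_def)
  then show "u \<in> biinf_factors x" unfolding biinf_factors_def by blast
qed

lemma stream_factors_eq_factors: "stream_factors x = factors (snth x)"
proof (intro set_eqI iffI)
  fix u assume "u \<in> stream_factors x"
  then obtain p s where x: "x = p @- u @- s" unfolding stream_factors_def by blast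
  have "occurs_at (snth x) (length p) u"
    unfolding x occurs_at_def by simp
  then show "u \<in> factors (snth x)" by (rule factorsI)
next
  fix u assume "u \<in> factors (snth x)"
  then obtain i where "occurs_at (snth x) i u" unfolding factors_def by blast
  then have "u = stake (length u) (sdrop i x)"
    by (intro nth_equalityI) (auto simp: occurs_at_def sdrop_snth add.commute)
  then have "x = stake i x @- u @- sdrop (length u) (sdrop i x)"
    by (metis stake_sdrop)
  then show "u \<in> stream_factors x" unfolding stream_factors_def by blast
qed

lemma pd_eq: "pd = smap pd_letter (fromN 0)"
  using pd_fixed_point pd_fixed_point_iff by blast

lemma stream_factors_pd: "stream_factors pd = factors pd_letter"
proof -
  have "snth pd = pd_letter"
    by (rule ext) (simp add: pd_eq)
  then show ?thesis by (simp add: stream_factors_eq_factors)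
qed

section \<open>Desubstitution under the period-doubling morphism\<close>

text \<open>\<open>x\<close> is cut into blocks, with the image of \<open>y i\<close> at
  \<open>c + 2 * i\<close>. The last conjunct makes the blocks cover every index, which over
  \<open>nat\<close> forces \<open>c = 0\<close>.\<close>

definition desubst_at :: "'i::comm_semiring_1 \<Rightarrow> ('i \<Rightarrow> letter) \<Rightarrow> ('i \<Rightarrow> letter) \<Rightarrow> bool" where
  "desubst_at c x y \<longleftrightarrow> (\<forall>i. x (c + 2 * i) = Zero \<and>
     x (c + 2 * i + 1) = (if y i = Zero then One else Zero)) \<and>
     (\<forall>i. \<exists>j. i = c + 2 * j \<or> i = c + 2 * j + 1)"

lemma desubst_atD:
  assumes "desubst_at c x y"
  shows "x (c + 2 * i) = Zero" "x (c + 2 * i + 1) = (if y i = Zero then One else Zero)"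
    "\<exists>e<2. \<exists>j. i = c + 2 * j + of_nat e"
proof -
  show "x (c + 2 * i) = Zero" "x (c + 2 * i + 1) = (if y i = Zero then One else Zero)"
    using assms unfolding desubst_at_def by blast+
  obtain j where "i = c + 2 * j \<or> i = c + 2 * j + 1"
    using assms unfolding desubst_at_def by blast
  then have "i = c + 2 * j + of_nat 0 \<or> i = c + 2 * j + of_nat 1"
    by simp
  then show "\<exists>e<2. \<exists>j. i = c + 2 * j + of_nat e"
    by (metis one_less_numeral_iff semiring_norm(76) zero_less_numeral)
qed

lemma desubst_at_pd_letter: "desubst_at 0 pd_letter pd_letter"
  unfolding desubst_at_def
proof (intro conjI allI)
  fix i :: nat
  show "pd_letter (0 + 2 * i) = Zero" by (simp add: pd_letter.simps)
  show "pd_letter (0 + 2 * i + 1) = (if pd_letter i = Zero then One else Zero)"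
    using pd_letter.simps[of "0 + 2 * i + 1"] by simp
  show "\<exists>j. i = 0 + 2 * j \<or> i = 0 + 2 * j + 1" by presburger
qed

lemma occurs_at_morph_pd_morph:
  assumes "desubst_at c x y" and "occurs_at y j v"
  shows "occurs_at x (c + 2 * j) (morph pd_morph v)"
  using assms(2)
proof (induction v arbitrary: j)
  case Nil
  show ?case by (simp add: morph_def)
next
  case (Cons a v)
  have "occurs_at x (c + 2 * (j + 1)) (morph pd_morph v)"
    using Cons.IH[of "j + 1"] Cons.prems by (simp only: occurs_at_Cons)
  moreover have "c + 2 * (j + 1) = c + 2 * j + 1 + 1"
    by (simp add: algebra_simps flip: one_add_one)
  ultimately show ?case
    using desubst_atD(1,2)[OF assms(1), of j] Cons.prems
    by (cases a) (simp_all add: morph_def)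
qed

lemma morph_in_factors:
  assumes "desubst_at c x y" and "v \<in> factors y"
  shows "morph pd_morph v \<in> factors x"
  using assms occurs_at_morph_pd_morph unfolding factors_def by blast

lemma desubst_at_nth:
  assumes "desubst_at c x y"
  shows "x (c + 2 * j + of_nat k) =
    (if even k then Zero else if y (j + of_nat (k div 2)) = Zero then One else Zero)"
proof (cases "even k")
  case True
  then obtain m where m: "k = 2 * m" by blast
  have "c + 2 * j + of_nat k = c + 2 * (j + of_nat m)"
    by (simp add: m algebra_simps)
  then show ?thesis using True desubst_atD(1)[OF assms, of "j + of_nat m"] by simp
next
  case False
  then obtain m where m: "k = 2 * m + 1" by (auto elim: oddE)
  have "c + 2 * j + of_nat k = c + 2 * (j + of_nat m) + 1"
    by (simp add: m algebra_simps)
  then show ?thesis using False m desubst_atD(2)[OF assms, of "j + of_nat m"] by simp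
qed

text \<open>The blocks met by \<open>u\<close> come from a factor \<open>v\<close> of
  \<open>y\<close>, shorter than \<open>u\<close> as soon as \<open>u\<close> has at least 3
  letters. A copy of \<open>v\<close> in \<open>Y\<close> has an image containing \<open>u\<close>
  at the same offset \<open>e\<close>.\<close>

lemma factors_desubst_step:
  assumes x: "desubst_at c x y" and X: "desubst_at d X Y"
    and shorter: "\<And>v. length v < length u \<Longrightarrow> v \<in> factors y \<Longrightarrow> v \<in> factors Y"
    and u: "u \<in> factors x" "length u \<ge> 3"
  shows "u \<in> factors X"
proof -
  obtain i where i: "occurs_at x i u" using u(1) unfolding factors_def by blast
  obtain e j where e: "e < 2" and j: "i = c + 2 * j + of_nat e"
    using desubst_atD(3)[OF x] by blast
  \<comment> \<open>The offsets from \<open>e\<close> to \<open>e + length u - 1\<close> meet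
    exactly this many blocks of length 2.\<close>
  define v where "v = map (\<lambda>k. y (j + of_nat k)) [0..<(length u + e + 1) div 2]"
  have "v \<in> factors y"
    by (rule factorsI[of _ j]) (simp add: v_def occurs_at_def)
  moreover have "length v < length u"
    using u(2) e by (simp add: v_def)
  ultimately obtain n where n: "occurs_at Y n v"
    using shorter unfolding factors_def by blast
  have "occurs_at X (d + 2 * n + of_nat e) u"
    unfolding occurs_at_def
  proof (intro allI impI)
    fix k assume k: "k < length u"
    then have "(e + k) div 2 < length v"
      by (simp add: v_def)
    then have "Y (n + of_nat ((e + k) div 2)) = y (j + of_nat ((e + k) div 2))"
      using n by (simp add: occurs_at_def v_def)
    \<comment> \<open>Both sides depend only on the parity of \<open>e + k\<close> and on one letter
      of the preimage, on which \<open>Y\<close> and \<open>y\<close> agree.\<close>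
    then have "X (d + 2 * n + of_nat (e + k)) = x (c + 2 * j + of_nat (e + k))"
      by (simp only: desubst_at_nth[OF x] desubst_at_nth[OF X])
    also have "\<dots> = u ! k"
      using i k by (simp add: occurs_at_def j add.assoc)
    finally show "X (d + 2 * n + of_nat e + of_nat k) = u ! k"
      by (simp add: add.assoc)
  qed
  then show ?thesis by (rule factorsI)
qed

section \<open>Occurrences of formulas\<close>

lemma contains_AA_ABAB_BB:
  assumes "a \<noteq> []" "b \<noteq> []" "a @ a \<in> L" "a @ b @ a @ b \<in> L" "b @ b \<in> L"
  shows "contains_formula L AA_ABAB_BB"
  unfolding contains_formula_def
  by (rule exI[of _ "case_pvar a b"])
    (use assms in \<open>auto simp: nonerasing_def morph_def AA_ABAB_BB_def split: pvar.split\<close>)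

lemma morph_morph: "morph g (morph h u) = morph (morph g \<circ> h) u"
  by (induction u) (simp_all add: morph_def)

lemma contains_formula_desubst_at:
  assumes "desubst_at c x y" and "contains_formula (factors y) \<phi>"
  shows "contains_formula (factors x) \<phi>"
proof -
  obtain h where h: "nonerasing h" "\<forall>u\<in>set \<phi>. morph h u \<in> factors y"
    using assms(2) unfolding contains_formula_def by blast
  have "morph pd_morph v \<noteq> []" if "v \<noteq> []" for v
    using that by (cases v; cases "hd v") (auto simp: morph_def)
  then have "nonerasing (morph pd_morph \<circ> h)"
    using h(1) by (simp add: nonerasing_def)
  moreover have "\<forall>u\<in>set \<phi>. morph (morph pd_morph \<circ> h) u \<in> factors x"
    using h(2) morph_in_factors[OF assms(1)] by (simp flip: morph_morph)
  ultimately show ?thesis unfolding contains_formula_def by blast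
qed

section \<open>Binary words avoiding the formula and 11\<close>

text \<open>A locale, since preimages of such words satisfy the same assumptions and the facts below
  are applied to them too.\<close>

locale avoiding_word =
  fixes w :: "int \<Rightarrow> letter"
  assumes no_formula: "\<not> contains_formula (factors w) AA_ABAB_BB"
    and no_11: "[One, One] \<notin> factors w"
begin

lemma no_square_pattern:
  assumes "a \<noteq> []" "b \<noteq> []"
  shows "\<not> (occurs_at w i (a @ a) \<and> occurs_at w j (a @ b @ a @ b) \<and> occurs_at w k (b @ b))"
  using contains_AA_ABAB_BB[OF assms, of "factors w"] no_formula factorsI by metis

lemma after_One: "w i = One \<Longrightarrow> w (i + 1) = Zero"
  using no_11 factorsI[of w i "[One, One]"] by (cases "w (i + 1)") auto

lemma before_One: "w i = One \<Longrightarrow> w (i - 1) = Zero"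
  using after_One[of "i - 1"] by (cases "w (i - 1)") auto

text \<open>For A = B = 0 all three fragments are factors of 0000.\<close>

lemma One_after_000:
  assumes "w i = Zero" "w (i + 1) = Zero" "w (i + 2) = Zero"
  shows "w (i + 3) = One"
  using no_square_pattern[of "[Zero]" "[Zero]" i i i] assms by (cases "w (i + 3)") (simp_all add: add_ac)

lemma next_1001:
  assumes "occurs_at w i [One, Zero, Zero, One]"
  shows "occurs_at w (i + 3) [One, Zero, Zero, One]"
proof -
  have w0: "w i = One" "w (i + 1) = Zero" "w (i + 2) = Zero" "w (i + 3) = One"
    using assms by (simp_all add: add_ac)
  have w1: "w (i - 1) = Zero" "w (i + 4) = Zero"
    using before_One[OF w0(1)] after_One[OF w0(4)] by (simp_all add: add_ac)
  \<comment> \<open>Otherwise 1010010 starts at \<open>i - 2\<close>: take A = 0 and B = 10.\<close>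
  have "w (i - 2) = Zero"
    using no_square_pattern[of "[Zero]" "[One, Zero]" "i + 1" "i - 1" "i - 2"] w0 w1
    by (cases "w (i - 2)") (simp_all add: add_ac)
  \<comment> \<open>Otherwise 0100101 starts at \<open>i - 1\<close>: take A = 01 and B = 0.\<close>
  have "w (i + 5) = Zero"
    using no_square_pattern[of "[Zero, One]" "[Zero]" "i + 2" "i - 1" "i + 1"] w0 w1
    by (cases "w (i + 5)") (simp_all add: add_ac)
  have "w (i + 6) = One"
  proof (rule ccontr)
    assume "w (i + 6) \<noteq> One"
    then have w6: "w (i + 6) = Zero" by (cases "w (i + 6)") (simp_all add: add_ac)
    then have w7: "w (i + 7) = One"
      using One_after_000[of "i + 4"] w1 \<open>w (i + 5) = Zero\<close> by (simp add: add_ac)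
    then have "w (i + 8) = Zero"
      using after_One[of "i + 7"] by (simp add: add_ac)
    \<comment> \<open>Now 00100100010 starts at \<open>i - 2\<close>: take A = 001 and B = 0. The 0
      at \<open>i - 2\<close> completes the square of A.\<close>
    then show False
      using no_square_pattern[of "[Zero, Zero, One]" "[Zero]" "i - 2" "i + 1" "i + 1"]
        w0 w1 w6 w7 \<open>w (i + 5) = Zero\<close> \<open>w (i - 2) = Zero\<close> by (simp add: add_ac)
  qed
  then show ?thesis using w0 w1 \<open>w (i + 5) = Zero\<close> by (simp add: add_ac)
qed

lemma no_1001: "\<not> occurs_at w i [One, Zero, Zero, One]"
proof
  assume 0: "occurs_at w i [One, Zero, Zero, One]"
  note 3 = next_1001[OF 0]
  note 6 = next_1001[OF 3]
  note 9 = next_1001[OF 6]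
  \<comment> \<open>Overlapping in one letter each, the four occurrences spell four copies of 100
    followed by 1.\<close>
  show False
    using no_square_pattern[of "[One, Zero, Zero]" "[One, Zero, Zero]" i i i] 0 3 6 9 by (simp add: add_ac)
qed

text \<open>The next 1 after \<open>p\<close> is at distance 2 or 4: 11 excludes distance 1, 1001
  excludes 3, and 0000 excludes more than 4. The induction jumps to that 1, lowering
  \<open>k\<close> by 1 or 2.\<close>

lemma Zero_at_odd_distance_right: "w p = One \<Longrightarrow> w (p + 2 * int k + 1) = Zero"
proof (induction k arbitrary: p rule: less_induct)
  case (less k)
  note p1 = after_One[OF less.prems]
  show ?case
  proof (cases "w (p + 2)")
    case One
    show ?thesis
    proof (cases k)
      case (Suc m)
      then show ?thesis using less.IH[of m "p + 2"] One by (simp add: algebra_simps)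
    qed (use p1 in simp)
  next
    case Zero
    then have p3: "w (p + 3) = Zero"
      using no_1001[of p] less.prems p1 Zero by (cases "w (p + 3)") (simp_all add: add_ac)
    then have p4: "w (p + 4) = One"
      using One_after_000[of "p + 1"] p1 Zero by (simp add: add_ac)
    consider "k = 0" | "k = 1" | m where "k = m + 2"
      by (metis add.commute add_2_eq_Suc not0_implies_Suc One_nat_def)
    then show ?thesis
    proof cases
      case 3
      then show ?thesis using less.IH[of m "p + 4"] p4 by (simp add: algebra_simps)
    qed (use p1 p3 in \<open>simp_all add: add_ac\<close>)
  qed
qed

lemma Zero_at_odd_distance:
  assumes "w p = One"
  shows "w (p + 2 * i + 1) = Zero"
proof (cases "i \<ge> 0")
  case True
  then show ?thesis using Zero_at_odd_distance_right[OF assms, of "nat i"] by simp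
next
  case False
  have "w (p + 2 * i + 1) \<noteq> One"
  proof
    assume "w (p + 2 * i + 1) = One"
    \<comment> \<open>Seen from a 1 on the left, \<open>p\<close> itself lies at odd distance to the
      right; the index here is equal to \<open>p\<close>.\<close>
    then have "w (p + 2 * i + 1 + 2 * int (nat (- i - 1)) + 1) = Zero"
      by (rule Zero_at_odd_distance_right)
    then show False using assms False by simp
  qed
  then show ?thesis by (cases "w (p + 2 * i + 1)") simp_all
qed

lemma One_occurs: "\<exists>p. w p = One"
  using One_after_000[of 0] by (metis letter.exhaust)

lemma desubst: "\<exists>c y. desubst_at c w y \<and> avoiding_word y"
proof -
  obtain p where p: "w p = One" using One_occurs by blast
  \<comment> \<open>Blocks start right after a 1, at \<open>p + 1 + 2 * i\<close>. Their second
    letter determines the preimage: 01 comes from 0, and 00 from 1.\<close>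
  define y where "y i = (if w (p + 2 * i + 2) = Zero then One else Zero)" for i
  have "desubst_at (p + 1) w y"
    unfolding desubst_at_def
  proof (intro conjI allI)
    fix i :: int
    show "w (p + 1 + 2 * i) = Zero"
      using Zero_at_odd_distance[OF p, of i] by (simp add: add_ac)
    show "w (p + 1 + 2 * i + 1) = (if y i = Zero then One else Zero)"
      by (cases "w (p + 2 * i + 2)") (simp_all add: y_def add_ac)
    show "\<exists>j. i = p + 1 + 2 * j \<or> i = p + 1 + 2 * j + 1" by presburger
  qed
  moreover have "avoiding_word y"
  proof
    show "\<not> contains_formula (factors y) AA_ABAB_BB"
      using contains_formula_desubst_at[OF \<open>desubst_at (p + 1) w y\<close>] no_formula by blast
    show "[One, One] \<notin> factors y"
    proof
      assume "[One, One] \<in> factors y"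
      then have "morph pd_morph [One, One] \<in> factors w"
        by (rule morph_in_factors[OF \<open>desubst_at (p + 1) w y\<close>])
      then obtain i where "occurs_at w i [Zero, Zero, Zero, Zero]"
        unfolding factors_def by (auto simp: morph_def)
      then show False using One_after_000[of i] by (simp add: add_ac)
    qed
  qed
  ultimately show ?thesis by blast
qed

lemma short_factors_iff:
  assumes "length u \<le> 2"
  shows "u \<in> factors w \<longleftrightarrow> u \<noteq> [One, One]"
proof
  assume u: "u \<noteq> [One, One]"
  obtain p where p: "w p = One" using One_occurs by blast
  obtain c y where y: "desubst_at c w y" "avoiding_word y" using desubst by blast
  \<comment> \<open>The factor 00 is found as the image of a 1 in the preimage.\<close>
  obtain q where q: "y q = One" using avoiding_word.One_occurs[OF y(2)] by blast
  have "[Zero, Zero] \<in> factors w"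
    using q desubst_atD(1,2)[OF y(1), of q] by (intro factorsI[of _ "c + 2 * q"]) simp
  moreover have "[One, Zero] \<in> factors w"
    using p after_One by (intro factorsI[of _ p]) simp
  moreover have "[Zero, One] \<in> factors w"
    using p before_One by (intro factorsI[of _ "p - 1"]) simp
  moreover have "[] \<in> factors w" "[One] \<in> factors w" "[Zero] \<in> factors w"
    using p after_One[OF p] by (auto intro: factorsI[of _ p] factorsI[of _ "p + 1"])
  moreover have "u \<in> {[], [Zero], [One], [Zero, Zero], [Zero, One], [One, Zero]}"
    using assms u by (auto simp: le_Suc_eq numeral_2_eq_2 length_Suc_conv intro: letter.exhaust)
  ultimately show "u \<in> factors w" by blast
qed (use no_11 in blast)

end

section \<open>Comparison with the period-doubling word\<close>

lemma short_factors_pd_iff: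
  assumes "length u \<le> 2"
  shows "u \<in> factors pd_letter \<longleftrightarrow> u \<noteq> [One, One]"
proof
  assume u: "u \<noteq> [One, One]"
  \<comment> \<open>The prefix 0100 contains every word of length at most 2 except 11.\<close>
  have pd: "pd_letter 0 = Zero" "pd_letter (Suc 0) = One" "pd_letter 2 = Zero" "pd_letter 3 = Zero"
    using desubst_at_nth[OF desubst_at_pd_letter, of 0] by auto
  have "u \<in> {[], [Zero], [One], [Zero, Zero], [Zero, One], [One, Zero]}"
    using assms u by (auto simp: le_Suc_eq numeral_2_eq_2 length_Suc_conv intro: letter.exhaust)
  moreover have "[] \<in> factors pd_letter" "[Zero] \<in> factors pd_letter" "[Zero, One] \<in> factors pd_letter"
    by (rule factorsI[of _ 0]; simp add: pd)+
  moreover have "[One] \<in> factors pd_letter" "[One, Zero] \<in> factors pd_letter"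
    by (rule factorsI[of _ 1]; simp add: pd flip: numeral_2_eq_2)+
  moreover have "[Zero, Zero] \<in> factors pd_letter"
    by (rule factorsI[of _ 2]) (simp add: pd)
  ultimately show "u \<in> factors pd_letter" by blast
next
  assume "u \<in> factors pd_letter"
  then obtain i where i: "occurs_at pd_letter i u" unfolding factors_def by blast
  \<comment> \<open>One of the two indices is even.\<close>
  have "pd_letter i = Zero \<or> pd_letter (Suc i) = Zero"
    by (simp add: pd_letter.simps[of i] pd_letter.simps[of "Suc i"])
  then show "u \<noteq> [One, One]" using i by auto
qed

text \<open>The induction on the length leaves \<open>w\<close> arbitrary, because its hypothesis is
  applied to the preimage of \<open>w\<close>, whereas \<open>pd_letter\<close> is its own preimage.
  \<open>factors_desubst_step\<close> then gives both inclusions.\<close>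

lemma avoiding_word_factors:
  assumes "avoiding_word w"
  shows "u \<in> factors w \<longleftrightarrow> u \<in> factors pd_letter"
  using assms
proof (induction "length u" arbitrary: u w rule: less_induct)
  case less
  show ?case
  proof (cases "length u \<le> 2")
    case True
    then show ?thesis
      using avoiding_word.short_factors_iff[OF less.prems] short_factors_pd_iff by blast
  next
    case False
    obtain c y where y: "desubst_at c w y" "avoiding_word y"
      using avoiding_word.desubst[OF less.prems] by blast
    have IH: "v \<in> factors y \<longleftrightarrow> v \<in> factors pd_letter" if "length v < length u" for v
      using less.hyps[OF that y(2)] .
    show ?thesis
      using factors_desubst_step[OF y(1) desubst_at_pd_letter, of u]
        factors_desubst_step[OF desubst_at_pd_letter y(1), of u] IH False by auto
  qed
qed

theorem theorem11:
  fixes w :: "int \<Rightarrow> letter"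
  assumes "\<not> contains_formula (biinf_factors w) AA_ABAB_BB"
    and "[One, One] \<notin> biinf_factors w"
  shows "biinf_factors w = stream_factors pd"
proof -
  have "avoiding_word w"
    using assms by unfold_locales (simp_all add: biinf_factors_eq_factors)
  then show ?thesis
    using avoiding_word_factors
    by (auto simp: biinf_factors_eq_factors stream_factors_pd)
qed

end
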